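(* Let $1/2<\alpha\leq 1$, $\varepsilon>0$ and $0<\rho\leq \alpha$ be constants, and let $p=p(n)\in(0,1]$ satisfy $p\,n/\ln n\to\infty$ as $n\to\infty$. Then there is a function $g(n)\to\infty$ such that for all sufficiently large $n$ the following holds. Suppose that $G$ is a bipartite graph with parts $A$ and $B$, both of size $n$, that $\delta(G)\geq \alpha n$, and that $G$ contains a $\rho n$-factor. Then, with probability at least $1-n^{-g(n)}$, the random subgraph $G'\sim G_p$ has a $k$-factor for $k=(1-\varepsilon)\rho np$.
   Context: For a graph $G$ and $0<p\leq 1$, $G'\sim G_p$ denotes the random spanning subgraph of $G$ obtained by retaining every edge of $G$ independently with probability $p$. An $r$-factor of a graph is a spanning $r$-regular subgraph. $\delta(G)$ denotes the minimum degree. The paper states the hypothesis as $p=\omega(\ln n/n)$ and the conclusion as holding with probability $1-n^{-\omega(1)}$. *)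

theory Defs
  imports "HOL-Probability.Probability"
begin

datatype 'v graph = Graph (verts: "'v set") (edges: "'v set set")

definition simple_graph :: "'v graph \<Rightarrow> bool" where
  "simple_graph G \<longleftrightarrow> finite (verts G) \<and> (\<forall>e\<in>edges G. e \<subseteq> verts G \<and> card e = 2)"

definition degree :: "'v graph \<Rightarrow> 'v \<Rightarrow> nat" where
  "degree G v = card {e \<in> edges G. v \<in> e}"

text \<open>Only meaningful for a graph with finite nonempty vertex set.\<close>

definition min_degree :: "'v graph \<Rightarrow> nat" where
  "min_degree G = Min (degree G ` verts G)"

definition bipartite_with :: "'v graph \<Rightarrow> 'v set \<Rightarrow> 'v set \<Rightarrow> bool" where
  "bipartite_with G A B \<longleftrightarrow> simple_graph G \<and> A \<inter> B = {} \<and> A \<union> B = verts G \<and>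
     (\<forall>e\<in>edges G. \<exists>a\<in>A. \<exists>b\<in>B. e = {a, b})"

definition spanning_subgraph :: "'v graph \<Rightarrow> 'v graph \<Rightarrow> bool" where
  "spanning_subgraph H G \<longleftrightarrow> verts H = verts G \<and> edges H \<subseteq> edges G"

definition regular :: "nat \<Rightarrow> 'v graph \<Rightarrow> bool" where
  "regular r G \<longleftrightarrow> (\<forall>v\<in>verts G. degree G v = r)"

definition has_factor :: "nat \<Rightarrow> 'v graph \<Rightarrow> bool" where
  "has_factor r G \<longleftrightarrow> (\<exists>H. spanning_subgraph H G \<and> regular r H)"

text \<open>
  The distribution of the random spanning subgraph of a finite graph: one independent coin of
  bias \<open>p\<close> per edge, an edge being kept iff its coin shows \<open>True\<close>. The \<open>False\<close> argument of
  \<^const>\<open>Pi_pmf\<close> is only the dummy value outside the edge set.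
\<close>

definition random_subgraph :: "'v graph \<Rightarrow> real \<Rightarrow> 'v graph pmf" where
  "random_subgraph G p =
     map_pmf (\<lambda>c. Graph (verts G) {e \<in> edges G. c e})
       (Pi_pmf (edges G) False (\<lambda>_. bernoulli_pmf p))"

end

theory Submission
  imports Defs
begin

text \<open>By the Ore--Ryser criterion, a bipartite graph with parts of size \<open>n\<close> has a \<open>k\<close>-factor as soon
  as \<open>e(X, Y) \<ge> k (|X| + |Y| - n)\<close> for all \<open>X \<subseteq> A\<close>, \<open>Y \<subseteq> B\<close>. The \<open>\<rho> n\<close>-factor of \<open>G\<close> gives
  \<open>e(X, Y) \<ge> \<rho> n (|X| + |Y| - n)\<close> in \<open>G\<close>, so the random subgraph satisfies the criterion unless
  \<open>e(X, Y)\<close> falls below its mean by a constant factor for some pair with \<open>|X| + |Y| > n\<close>. Say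
  \<open>|Y| \<le> |X|\<close>; then \<open>|X| > n / 2\<close> and the degree condition gives
  \<open>e(X, Y) \<ge> (\<alpha> - 1 / 2) n |Y|\<close>. By Chernoff the pair is bad with probability at most
  \<open>t ^ (2 |Y|) \<le> t ^ (|A - X| + |Y|)\<close> where \<open>t = exp (- \<Omega>(n p)) = n powr (- \<omega>(1))\<close>, and the sum of
  these weights over all pairs with nonempty \<open>Y\<close> is \<open>(1 + t)^n ((1 + t)^n - 1) = O(n t)\<close>.\<close>

section \<open>Hall's theorem with demands\<close>

text \<open>Rado's argument: shrink the family while Hall's condition holds. If an element \<open>t\<close> were
  still shared by two sets, neither copy could be removed, so both lie in tight subfamilies;
  submodularity of the union size, strict because of \<open>t\<close>, gives a contradiction.\<close>

lemma hall_with_demands: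
  fixes N :: "'i \<Rightarrow> 'e set" and l :: "'i \<Rightarrow> nat"
  assumes fS: "finite S" and fN: "\<And>i. i \<in> S \<Longrightarrow> finite (N i)"
    and hall: "\<And>J. J \<subseteq> S \<Longrightarrow> sum l J \<le> card (\<Union>i\<in>J. N i)"
  obtains M where "\<And>i. i \<in> S \<Longrightarrow> M i \<subseteq> N i" "\<And>i. i \<in> S \<Longrightarrow> l i \<le> card (M i)"
    "disjoint_family_on M S"
proof -
  define P where "P M \<longleftrightarrow> (\<forall>i\<in>S. M i \<subseteq> N i) \<and> (\<forall>J\<subseteq>S. sum l J \<le> card (\<Union>i\<in>J. M i))"
    for M :: "'i \<Rightarrow> 'e set"
  have "P N" using hall by (auto simp: P_def)
  then obtain M where PM: "P M"
    and least: "\<And>M'. P M' \<Longrightarrow> (\<Sum>i\<in>S. card (M i)) \<le> (\<Sum>i\<in>S. card (M' i))"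
    using ex_has_least_nat[of P N "\<lambda>M. \<Sum>i\<in>S. card (M i)"] by blast
  have MN: "M i \<subseteq> N i" if "i \<in> S" for i using PM that by (auto simp: P_def)
  have fM: "finite (M i)" if "i \<in> S" for i using MN fN that finite_subset by blast
  have HM: "sum l J \<le> card (\<Union>i\<in>J. M i)" if "J \<subseteq> S" for J
    using PM that by (auto simp: P_def)
  have fU: "finite (\<Union>i\<in>J. M i)" if "J \<subseteq> S" for J
    using finite_subset[OF that fS] fM that by blast
  \<comment> \<open>Removing \<open>t\<close> from \<open>M i\<close> breaks Hall's condition on
    some \<open>J\<close>. The union over \<open>J\<close> must shrink, so \<open>i\<close> is the
    only index in \<open>J\<close> whose set holds \<open>t\<close>; it shrinks by one element only,
    so \<open>J\<close> was tight.\<close>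
  have critical: "\<exists>J. J \<subseteq> S \<and> i \<in> J \<and> t \<notin> (\<Union>j\<in>J - {i}. M j) \<and> card (\<Union>j\<in>J. M j) = sum l J"
    if i: "i \<in> S" and t: "t \<in> M i" for i t
  proof -
    define M' where "M' = M(i := M i - {t})"
    have "(\<Sum>j\<in>S. card (M' j)) < (\<Sum>j\<in>S. card (M j))"
    proof (rule sum_strict_mono_ex1[OF fS])
      show "\<forall>j\<in>S. card (M' j) \<le> card (M j)" using fM by (auto simp: M'_def intro: card_mono)
      show "\<exists>j\<in>S. card (M' j) < card (M j)"
        using card_Diff1_less[OF fM[OF i] t] i by (intro bexI[of _ i]) (auto simp: M'_def simp del: card_Diff_insert)
    qed
    then have "\<not> P M'" using least by (metis linorder_not_less)
    moreover have "\<forall>j\<in>S. M' j \<subseteq> N j" using MN by (auto simp: M'_def)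
    ultimately obtain J where J: "J \<subseteq> S" and bad: "card (\<Union>j\<in>J. M' j) < sum l J"
      by (auto simp: P_def not_le)
    have sub: "(\<Union>j\<in>J. M j) \<subseteq> insert t (\<Union>j\<in>J. M' j)" by (auto simp: M'_def)
    have iJ: "i \<in> J"
    proof (rule ccontr)
      assume "i \<notin> J"
      then have "(\<Union>j\<in>J. M' j) = (\<Union>j\<in>J. M j)" by (auto simp: M'_def)
      then show False using HM[OF J] bad by simp
    qed
    have tn: "t \<notin> (\<Union>j\<in>J - {i}. M j)"
    proof
      assume "t \<in> (\<Union>j\<in>J - {i}. M j)"
      then have "t \<in> (\<Union>j\<in>J. M' j)" by (auto simp: M'_def)
      then have "(\<Union>j\<in>J. M j) \<subseteq> (\<Union>j\<in>J. M' j)" using sub by blast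
      moreover have "(\<Union>j\<in>J. M' j) \<subseteq> (\<Union>j\<in>J. M j)" by (auto simp: M'_def split: if_splits)
      ultimately have "(\<Union>j\<in>J. M j) = (\<Union>j\<in>J. M' j)" by (rule antisym)
      then show False using HM[OF J] bad by simp
    qed
    have fU': "finite (\<Union>j\<in>J. M' j)"
      by (rule finite_subset[OF _ fU[OF J]]) (auto simp: M'_def split: if_splits)
    have "card (\<Union>j\<in>J. M j) \<le> card (insert t (\<Union>j\<in>J. M' j))"
      using sub fU' by (intro card_mono) auto
    also have "\<dots> \<le> Suc (card (\<Union>j\<in>J. M' j))" by (simp add: card_insert_le_m1 fU' card_insert_if)
    also have "\<dots> \<le> sum l J" using bad by simp
    finally show ?thesis using J iJ tn HM[OF J] by (intro exI[of _ J]) auto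
  qed
  have disj: "M i \<inter> M j = {}" if i: "i \<in> S" and j: "j \<in> S" and ij: "i \<noteq> j" for i j
  proof (rule ccontr)
    assume "M i \<inter> M j \<noteq> {}"
    then obtain t where t: "t \<in> M i" "t \<in> M j" by blast
    obtain J1 where J1: "J1 \<subseteq> S" "i \<in> J1" "t \<notin> (\<Union>h\<in>J1 - {i}. M h)"
      "card (\<Union>h\<in>J1. M h) = sum l J1" using critical[OF i t(1)] by blast
    obtain J2 where J2: "J2 \<subseteq> S" "j \<in> J2" "t \<notin> (\<Union>h\<in>J2 - {j}. M h)"
      "card (\<Union>h\<in>J2. M h) = sum l J2" using critical[OF j t(2)] by blast
    have f: "finite J1" "finite J2" using J1 J2 fS finite_subset by auto
    let ?U = "\<lambda>J. \<Union>h\<in>J. M h"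
    \<comment> \<open>An index common to \<open>J1\<close> and \<open>J2\<close> differs from
      \<open>i\<close> or from \<open>j\<close>, and so its set misses \<open>t\<close>. But
      \<open>t\<close> lies in both unions, through \<open>i\<close> and \<open>j\<close>; this
      gives the extra 1 below.\<close>
    have tI: "t \<notin> ?U (J1 \<inter> J2)" using J1 J2 t ij by blast
    have fI: "finite (?U (J1 \<inter> J2))" using fU J1 by blast
    have "insert t (?U (J1 \<inter> J2)) \<subseteq> ?U J1 \<inter> ?U J2" using J1 J2 t by auto
    then have 1: "Suc (card (?U (J1 \<inter> J2))) \<le> card (?U J1 \<inter> ?U J2)"
      using tI fI fU J1 by (metis card_insert_disjoint card_mono finite_Int)
    have "card (?U J1) + card (?U J2) = card (?U (J1 \<union> J2)) + card (?U J1 \<inter> ?U J2)"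
      using card_Un_Int[OF fU[OF J1(1)] fU[OF J2(1)]] by (simp add: UN_Un)
    moreover have "sum l (J1 \<union> J2) \<le> card (?U (J1 \<union> J2))" using J1 J2 by (intro HM) auto
    moreover have "sum l (J1 \<inter> J2) \<le> card (?U (J1 \<inter> J2))" using J1 by (intro HM) auto
    moreover have "sum l (J1 \<union> J2) + sum l (J1 \<inter> J2) = sum l J1 + sum l J2"
      using f by (rule sum.union_inter)
    ultimately show False using 1 J1(4) J2(4) by linarith
  qed
  show ?thesis
  proof (rule that)
    show "M i \<subseteq> N i" if "i \<in> S" for i using MN that .
    show "l i \<le> card (M i)" if "i \<in> S" for i using HM[of "{i}"] that by simp
    show "disjoint_family_on M S" using disj by (auto simp: disjoint_family_on_def)
  qed
qed

section \<open>Counting edges in bipartite edge sets\<close>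

text \<open>Stated for bare edge sets: the factor and the random subgraph share the vertices of the
  host graph and differ from it only in their edges.\<close>

definition bipartite_edges :: "'v set set \<Rightarrow> 'v set \<Rightarrow> 'v set \<Rightarrow> bool" where
  "bipartite_edges E A B \<longleftrightarrow> finite A \<and> finite B \<and> A \<inter> B = {} \<and>
     (\<forall>e\<in>E. \<exists>a\<in>A. \<exists>b\<in>B. e = {a, b})"

text \<open>For \<open>X\<close> and \<open>Y\<close> on opposite sides this is the set counted by
  e(X, Y). The form is symmetric in \<open>X\<close> and \<open>Y\<close>, so that the two sides can
  be exchanged freely.\<close>

definition edges_between :: "'v set set \<Rightarrow> 'v set \<Rightarrow> 'v set \<Rightarrow> 'v set set" where
  "edges_between E X Y = {e \<in> E. e \<inter> X \<noteq> {} \<and> e \<inter> Y \<noteq> {}}"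

lemma bipartite_edges_mono: "bipartite_edges E A B \<Longrightarrow> F \<subseteq> E \<Longrightarrow> bipartite_edges F A B"
  by (simp add: bipartite_edges_def subset_iff)

lemma bipartite_edges_commute:
  assumes "bipartite_edges E A B"
  shows "bipartite_edges E B A"
proof -
  have "\<exists>b\<in>B. \<exists>a\<in>A. e = {b, a}" if e: "e \<in> E" for e
  proof -
    obtain a b where "a \<in> A" "b \<in> B" "e = {a, b}"
      using assms e by (auto simp: bipartite_edges_def)
    then show ?thesis by (intro bexI[of _ b] bexI[of _ a]) auto
  qed
  then show ?thesis using assms by (auto simp: bipartite_edges_def)
qed

lemma edges_between_commute: "edges_between E X Y = edges_between E Y X"
  unfolding edges_between_def by auto

lemma edges_between_mono: "F \<subseteq> E \<Longrightarrow> edges_between F X Y \<subseteq> edges_between E X Y"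
  unfolding edges_between_def by auto

lemma finite_bipartite_edges: "bipartite_edges E A B \<Longrightarrow> finite E"
  by (rule finite_subset[of _ "Pow (A \<union> B)"]) (auto simp: bipartite_edges_def)

text \<open>Makes the edge sets at different vertices of one side disjoint, so that degrees on that
  side add up to edge counts.\<close>

lemma bipartite_edge_meets_once:
  assumes "bipartite_edges E A B" "e \<in> E" "a \<in> A" "a' \<in> A" "a \<in> e" "a' \<in> e"
  shows "a = a'"
proof -
  obtain x y where "x \<in> A" "y \<in> B" "e = {x, y}" and "A \<inter> B = {}"
    using assms by (auto simp: bipartite_edges_def)
  then show ?thesis using assms by auto
qed

lemma card_edges_meeting:
  assumes bip: "bipartite_edges E A B" and X: "X \<subseteq> A"
  shows "card {e \<in> E. e \<inter> X \<noteq> {}} = (\<Sum>a\<in>X. card {e \<in> E. a \<in> e})"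
proof -
  have "{e \<in> E. e \<inter> X \<noteq> {}} = (\<Union>a\<in>X. {e \<in> E. a \<in> e})" by auto
  moreover have "card (\<Union>a\<in>X. {e \<in> E. a \<in> e}) = (\<Sum>a\<in>X. card {e \<in> E. a \<in> e})"
  proof (rule card_UN_disjoint)
    show "finite X" using bip X finite_subset unfolding bipartite_edges_def by blast
    show "\<forall>a\<in>X. finite {e \<in> E. a \<in> e}" using finite_bipartite_edges[OF bip] by auto
    show "\<forall>a\<in>X. \<forall>a'\<in>X. a \<noteq> a' \<longrightarrow> {e \<in> E. a \<in> e} \<inter> {e \<in> E. a' \<in> e} = {}"
      using bipartite_edge_meets_once[OF bip] X by blast
  qed
  ultimately show ?thesis by simp
qed

lemma card_edges_between:
  assumes bip: "bipartite_edges E A B" and X: "X \<subseteq> A" and Y: "Y \<subseteq> B"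
  shows "card {e \<in> E. e \<inter> X \<noteq> {}} = card (edges_between E X Y) + card (edges_between E X (B - Y))"
proof -
  have "{e \<in> E. e \<inter> X \<noteq> {}} = edges_between E X Y \<union> edges_between E X (B - Y)"
    using bip X Y unfolding bipartite_edges_def edges_between_def by fastforce
  moreover have "edges_between E X Y \<inter> edges_between E X (B - Y) = {}"
    using bipartite_edge_meets_once[OF bipartite_edges_commute[OF bip]] Y
    unfolding edges_between_def by blast
  moreover have "finite (edges_between E X Z)" for Z
    using finite_bipartite_edges[OF bip] unfolding edges_between_def by auto
  ultimately show ?thesis by (simp add: card_Un_disjoint)
qed

text \<open>Of the \<open>r * card X\<close> edges at \<open>X\<close>, at most
  \<open>r * (n - card Y)\<close> can end in \<open>B - Y\<close>. This is the necessity half of the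
  Ore-Ryser criterion, arranged to avoid truncated subtraction.\<close>

lemma regular_edges_between:
  assumes bip: "bipartite_edges E A B" and n: "card B = n"
    and reg: "\<And>v. v \<in> A \<union> B \<Longrightarrow> card {e \<in> E. v \<in> e} = r" and X: "X \<subseteq> A" and Y: "Y \<subseteq> B"
  shows "r * (card X + card Y) \<le> card (edges_between E X Y) + r * n"
proof -
  have fB: "finite B" and fE: "finite E"
    using bip finite_bipartite_edges[OF bip] by (auto simp: bipartite_edges_def)
  have "card (edges_between E X (B - Y)) \<le> card {e \<in> E. e \<inter> (B - Y) \<noteq> {}}"
    using fE by (intro card_mono) (auto simp: edges_between_def)
  also have "\<dots> = (\<Sum>b\<in>B - Y. card {e \<in> E. b \<in> e})"
    by (rule card_edges_meeting[OF bipartite_edges_commute[OF bip]]) auto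
  also have "\<dots> = r * card (B - Y)" using reg by simp
  also have "\<dots> = r * (n - card Y)" using Y fB n by (simp add: card_Diff_subset finite_subset)
  finally have 1: "card (edges_between E X (B - Y)) \<le> r * (n - card Y)" .
  have "card {e \<in> E. e \<inter> X \<noteq> {}} = r * card X"
    using reg X by (subst card_edges_meeting[OF bip X]) (simp add: subset_iff)
  then have 2: "r * card X = card (edges_between E X Y) + card (edges_between E X (B - Y))"
    using card_edges_between[OF bip X Y] by simp
  have "card Y \<le> n" using Y fB n card_mono by blast
  then have "r * n = r * (n - card Y) + r * card Y" by (simp flip: add_mult_distrib2)
  then show ?thesis using 1 2 unfolding add_mult_distrib2 by linarith
qed

section \<open>The Ore-Ryser criterion\<close>

text \<open>Every edge is handed to one of its endpoints: a vertex of \<open>A\<close> asks for \<open>k\<close> edges, which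
  are put into the factor, and a vertex of \<open>B\<close> asks for all but \<open>k\<close> of its edges, which are
  thrown away. The demands sum up to the number of edges, so all of them are met exactly.\<close>

lemma ore_ryser:
  assumes bip: "bipartite_edges E A B" and nA: "card A = n" and nB: "card B = n"
    and cut: "\<And>X Y. X \<subseteq> A \<Longrightarrow> Y \<subseteq> B \<Longrightarrow> k * (card X + card Y) \<le> card (edges_between E X Y) + k * n"
  shows "\<exists>F\<subseteq>E. \<forall>v\<in>A \<union> B. card {e \<in> F. v \<in> e} = k"
proof -
  note pib = bipartite_edges_commute[OF bip]
  have fA: "finite A" and fB: "finite B" and AB: "A \<inter> B = {}" and fE: "finite E"
    using bip finite_bipartite_edges[OF bip] by (auto simp: bipartite_edges_def)
  define N where "N v = {e \<in> E. v \<in> e}" for v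
  define l where "l v = (if v \<in> A then k else card (N v) - k)" for v
  have fN: "finite (N v)" for v using fE by (simp add: N_def)
  \<comment> \<open>The cut condition for \<open>A\<close> and \<open>{b}\<close>; it ensures that
    the subtraction in \<open>l\<close> never truncates.\<close>
  have degB: "k \<le> card (N b)" if b: "b \<in> B" for b
  proof -
    have "edges_between E A {b} \<subseteq> N b" by (auto simp: edges_between_def N_def)
    then have "card (edges_between E A {b}) \<le> card (N b)" using fN card_mono by blast
    then show ?thesis using cut[of A "{b}"] b nA by simp
  qed
  have split: "card (\<Union>v\<in>X \<union> Y. N v) = card (edges_between E X (B - Y)) + (\<Sum>b\<in>Y. card (N b))"
    if X: "X \<subseteq> A" and Y: "Y \<subseteq> B" for X Y
  proof -
    have "(\<Union>v\<in>X \<union> Y. N v) = edges_between E X (B - Y) \<union> {e \<in> E. e \<inter> Y \<noteq> {}}"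
      using bip X Y unfolding N_def edges_between_def bipartite_edges_def by fastforce
    moreover have "edges_between E X (B - Y) \<inter> {e \<in> E. e \<inter> Y \<noteq> {}} = {}"
      using bipartite_edge_meets_once[OF pib] Y unfolding edges_between_def by blast
    moreover have "card {e \<in> E. e \<inter> Y \<noteq> {}} = (\<Sum>b\<in>Y. card (N b))"
      using card_edges_meeting[OF pib Y] by (simp add: N_def)
    ultimately show ?thesis using fE by (simp add: card_Un_disjoint edges_between_def)
  qed
  have suml: "sum l (X \<union> Y) + k * card Y = k * card X + (\<Sum>b\<in>Y. card (N b))"
    if X: "X \<subseteq> A" and Y: "Y \<subseteq> B" for X Y
  proof -
    have f: "finite X" "finite Y" "X \<inter> Y = {}" using X Y fA fB AB finite_subset by auto
    have "sum l X = k * card X" using X by (simp add: l_def subset_iff)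
    moreover have "sum l Y = (\<Sum>b\<in>Y. card (N b) - k)"
      using Y AB by (intro sum.cong) (auto simp: l_def)
    moreover have "(\<Sum>b\<in>Y. card (N b) - k) + k * card Y = (\<Sum>b\<in>Y. card (N b))"
    proof -
      have "(\<Sum>b\<in>Y. card (N b) - k) + k * card Y = (\<Sum>b\<in>Y. (card (N b) - k) + k)"
        by (simp add: sum.distrib)
      also have "\<dots> = (\<Sum>b\<in>Y. card (N b))" using degB Y by (intro sum.cong) auto
      finally show ?thesis .
    qed
    ultimately show ?thesis using f by (simp add: sum.union_disjoint)
  qed
  have "\<exists>M. (\<forall>i\<in>A \<union> B. M i \<subseteq> N i) \<and> (\<forall>i\<in>A \<union> B. l i \<le> card (M i)) \<and> disjoint_family_on M (A \<union> B)"
  proof (rule hall_with_demands[of "A \<union> B" N l])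
    fix J assume "J \<subseteq> A \<union> B"
    define X Y where "X = J \<inter> A" and "Y = J \<inter> B"
    have J: "J = X \<union> Y" "X \<subseteq> A" "Y \<subseteq> B" using \<open>J \<subseteq> A \<union> B\<close> by (auto simp: X_def Y_def)
    have cY: "card Y \<le> n" using J fB nB card_mono by blast
    \<comment> \<open>Hall's condition for \<open>X \<union> Y\<close> is the cut condition for
      \<open>X\<close> and the complement \<open>B - Y\<close>.\<close>
    have "k * (card X + (n - card Y)) \<le> card (edges_between E X (B - Y)) + k * n"
      using cut[of X "B - Y"] J fB nB by (simp add: card_Diff_subset finite_subset)
    moreover have "k * n = k * (n - card Y) + k * card Y" using cY by (simp flip: add_mult_distrib2)
    ultimately have "k * card X \<le> card (edges_between E X (B - Y)) + k * card Y"
      unfolding add_mult_distrib2 by linarith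
    then show "sum l J \<le> card (\<Union>v\<in>J. N v)"
      using split[OF J(2,3)] suml[OF J(2,3)] unfolding J(1)[symmetric] by linarith
  qed (use fA fB fN in auto)
  then obtain M where MN: "\<And>v. v \<in> A \<union> B \<Longrightarrow> M v \<subseteq> N v"
    and Ml: "\<And>v. v \<in> A \<union> B \<Longrightarrow> l v \<le> card (M v)" and Md: "disjoint_family_on M (A \<union> B)"
    by blast
  have fM: "finite (M v)" if "v \<in> A \<union> B" for v using MN[OF that] fN finite_subset by blast
  have UE: "(\<Union>v\<in>A \<union> B. N v) = E"
    using bip unfolding N_def bipartite_edges_def by fastforce
  have "(\<Sum>v\<in>A \<union> B. card (M v)) = card (\<Union>v\<in>A \<union> B. M v)"
    using fA fB fM Md by (intro card_UN_disjoint[symmetric]) (auto simp: disjoint_family_on_def)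
  moreover have UM: "(\<Union>v\<in>A \<union> B. M v) \<subseteq> E" using MN UE by blast
  \<comment> \<open>For \<open>Y = B\<close> no edge remains in the first term of
    \<open>split\<close>, and \<open>k * card A\<close> cancels \<open>k * card B\<close> in
    \<open>suml\<close>.\<close>
  moreover have "card E = sum l (A \<union> B)"
    using split[of A B] suml[of A B] UE nA nB by (simp add: edges_between_def)
  ultimately have le: "(\<Sum>v\<in>A \<union> B. card (M v)) \<le> sum l (A \<union> B)"
    and eqE: "card (\<Union>v\<in>A \<union> B. M v) = (\<Sum>v\<in>A \<union> B. card (M v))"
    and cE: "card E = sum l (A \<union> B)"
    using card_mono[OF fE UM] by auto
  have Ml': "card (M v) = l v" if "v \<in> A \<union> B" for v
  proof -
    have "sum l (A \<union> B) = (\<Sum>v\<in>A \<union> B. card (M v))"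
      by (intro antisym le sum_mono Ml)
    then show ?thesis using sum_mono_inv[of l "A \<union> B" "\<lambda>v. card (M v)" v] Ml that fA fB by auto
  qed
  have EM: "(\<Union>v\<in>A \<union> B. M v) = E"
    using eqE cE Ml' UM fE by (intro card_subset_eq) auto
  define F where "F = (\<Union>a\<in>A. M a)"
  have FE: "F \<subseteq> E" using EM by (auto simp: F_def)
  have "card {e \<in> F. v \<in> e} = k" if v: "v \<in> A \<union> B" for v
  proof (cases "v \<in> A")
    case True
    have "{e \<in> F. v \<in> e} = M v"
    proof
      show "{e \<in> F. v \<in> e} \<subseteq> M v"
        using bipartite_edge_meets_once[OF bip] MN FE True unfolding F_def N_def by blast
      show "M v \<subseteq> {e \<in> F. v \<in> e}" using MN[of v] True by (auto simp: F_def N_def)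
    qed
    then show ?thesis using Ml'[of v] True by (simp add: l_def)
  next
    case False
    then have vB: "v \<in> B" using v by blast
    \<comment> \<open>Each edge at \<open>v\<close> was handed either to \<open>v\<close> or to its
      endpoint in \<open>A\<close>; the latter edges form \<open>F\<close>. There are
      \<open>card (N v) - l v = k\<close> of them at \<open>v\<close>.\<close>
    have "{e \<in> F. v \<in> e} = N v - M v"
    proof
      show "{e \<in> F. v \<in> e} \<subseteq> N v - M v"
      proof
        fix e assume "e \<in> {e \<in> F. v \<in> e}"
        then obtain a where a: "a \<in> A" "e \<in> M a" "v \<in> e" by (auto simp: F_def)
        then have "M a \<inter> M v = {}" using v False by (intro disjoint_family_onD[OF Md]) auto
        then show "e \<in> N v - M v" using a MN[of a] by (auto simp: N_def)
      qed
      show "N v - M v \<subseteq> {e \<in> F. v \<in> e}"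
      proof
        fix e assume e: "e \<in> N v - M v"
        then obtain w where w: "w \<in> A \<union> B" "e \<in> M w" using EM by (auto simp: N_def)
        have "w \<notin> B"
        proof
          assume "w \<in> B"
          moreover have "w \<in> e" using w MN by (auto simp: N_def)
          ultimately have "w = v"
            using bipartite_edge_meets_once[OF pib] vB e by (auto simp: N_def)
          then show False using e w by blast
        qed
        then show "e \<in> {e \<in> F. v \<in> e}" using w e by (auto simp: F_def N_def)
      qed
    qed
    then have "card {e \<in> F. v \<in> e} = card (N v) - card (M v)"
      using MN[OF v] fM[OF v] by (simp add: card_Diff_subset)
    then show ?thesis using Ml'[OF v] False degB[OF vB] by (simp add: l_def)
  qed
  then show ?thesis using FE by blast
qed

section \<open>Edge counts from a degree bound\<close>

text \<open>Each vertex of \<open>Y\<close> has at least \<open>d\<close> neighbours, and at most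
  \<open>card (A - X)\<close> of them avoid \<open>X\<close>; sum over \<open>Y\<close>.\<close>

lemma dense_edges_between:
  assumes bip: "bipartite_edges E A B" and X: "X \<subseteq> A" and Y: "Y \<subseteq> B"
    and deg: "\<And>b. b \<in> B \<Longrightarrow> d \<le> real (card {e \<in> E. b \<in> e})"
  shows "real (card Y) * (d - real (card (A - X))) \<le> real (card (edges_between E X Y))"
proof -
  note pib = bipartite_edges_commute[OF bip]
  have fE: "finite E" using finite_bipartite_edges[OF bip] .
  have "d - real (card (A - X)) \<le> real (card {e \<in> edges_between E X Y. b \<in> e})" if b: "b \<in> Y" for b
  proof -
    have "{e \<in> E. b \<in> e} \<subseteq> {e \<in> edges_between E X Y. b \<in> e} \<union> (\<lambda>a. {a, b}) ` (A - X)"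
    proof
      fix e assume e: "e \<in> {e \<in> E. b \<in> e}"
      then obtain a b' where ab: "a \<in> A" "b' \<in> B" "e = {a, b'}"
        using bip by (auto simp: bipartite_edges_def)
      have "b' = b" using bipartite_edge_meets_once[OF pib] e ab b Y by blast
      then show "e \<in> {e \<in> edges_between E X Y. b \<in> e} \<union> (\<lambda>a. {a, b}) ` (A - X)"
        using e ab b by (auto simp: edges_between_def)
    qed
    then have "card {e \<in> E. b \<in> e} \<le> card ({e \<in> edges_between E X Y. b \<in> e} \<union> (\<lambda>a. {a, b}) ` (A - X))"
      using fE bip by (intro card_mono) (auto simp: bipartite_edges_def edges_between_def)
    also have "\<dots> \<le> card {e \<in> edges_between E X Y. b \<in> e} + card ((\<lambda>a. {a, b}) ` (A - X))"
      by (rule card_Un_le)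
    also have "\<dots> \<le> card {e \<in> edges_between E X Y. b \<in> e} + card (A - X)"
      using bip by (intro add_left_mono card_image_le) (auto simp: bipartite_edges_def)
    finally show ?thesis using deg[of b] b Y by fastforce
  qed
  then have "real (card Y) * (d - real (card (A - X)))
      \<le> (\<Sum>b\<in>Y. real (card {e \<in> edges_between E X Y. b \<in> e}))"
    using sum_mono[of Y "\<lambda>_. d - real (card (A - X))"] by simp
  also have "\<dots> = real (card {e \<in> edges_between E X Y. e \<inter> Y \<noteq> {}})"
    using card_edges_meeting[OF bipartite_edges_mono[OF pib] Y, of "edges_between E X Y"]
    by (simp add: edges_between_def)
  also have "{e \<in> edges_between E X Y. e \<inter> Y \<noteq> {}} = edges_between E X Y"
    by (auto simp: edges_between_def)
  finally show ?thesis .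
qed

section \<open>Lower tail of the number of retained edges\<close>

text \<open>The right side times \<open>1 + x + x\<^sup>2 / 2\<close> equals 1 + x^4 / 4, which is
  at least 1, and that second factor is at most \<open>exp x\<close>.\<close>

lemma exp_minus_le_quadratic:
  fixes x :: real
  assumes "0 \<le> x"
  shows "exp (- x) \<le> 1 - x + x\<^sup>2 / 2"
proof -
  have pos: "0 < 1 + x + x\<^sup>2 / 2" using assms by (simp add: add_pos_nonneg)
  have "(1 - x + x\<^sup>2 / 2) * (1 + x + x\<^sup>2 / 2) = 1 + (x\<^sup>2)\<^sup>2 / 4"
    by (simp add: power2_eq_square algebra_simps)
  then have "1 \<le> (1 - x + x\<^sup>2 / 2) * (1 + x + x\<^sup>2 / 2)" by simp
  then have "1 / (1 + x + x\<^sup>2 / 2) \<le> 1 - x + x\<^sup>2 / 2" using pos by (simp add: divide_le_eq)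
  moreover have "exp (- x) \<le> 1 / (1 + x + x\<^sup>2 / 2)"
    using exp_lower_Taylor_quadratic[OF assms] pos by (simp add: exp_minus' frac_le)
  ultimately show ?thesis by simp
qed

text \<open>Exponential moment method with parameter \<open>\<delta>\<close> itself instead of the
  optimal one; the quadratic bound on \<open>exp (- \<delta>)\<close> makes this enough.\<close>

lemma bernoulli_chernoff_lower:
  fixes p \<delta> :: real
  assumes fE: "finite E" and SE: "S \<subseteq> E" and p: "0 \<le> p" "p \<le> 1" and d: "0 \<le> \<delta>"
  shows "measure_pmf.prob (Pi_pmf E False (\<lambda>_. bernoulli_pmf p))
      {c. real (card {e \<in> S. c e}) \<le> (1 - \<delta>) * p * real (card S)}
    \<le> exp (- (\<delta>\<^sup>2 * p * real (card S) / 2))"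
proof -
  let ?M = "Pi_pmf E False (\<lambda>_. bernoulli_pmf p)"
  define a where "a = (1 - \<delta>) * p * real (card S)"
  \<comment> \<open>The factor that edge \<open>e\<close> contributes to the exponential moment. It
    is 1 outside \<open>S\<close>, so independence can be used over all of \<open>E\<close>.\<close>
  define h where "h e b = (if e \<in> S \<and> b then exp (- \<delta>) else 1)" for e and b :: bool
  have fS: "finite S" using SE fE finite_subset by blast
  have fset: "finite (set_pmf ?M)"
    by (rule finite_subset[OF set_Pi_pmf_subset'[OF fE]]) (intro finite_PiE_dflt fE, auto)
  have h_prod: "(\<Prod>e\<in>E. h e (c e)) = exp (- \<delta> * real (card {e \<in> S. c e}))" for c
  proof -
    have "(\<Prod>e\<in>E. h e (c e)) = (\<Prod>e\<in>{e \<in> S. c e}. exp (- \<delta>))"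
      using SE fE by (intro prod.mono_neutral_cong_right) (auto simp: h_def)
    then show ?thesis by (simp add: exp_of_nat_mult[symmetric] mult.commute)
  qed
  have "measure_pmf.prob ?M {c. real (card {e \<in> S. c e}) \<le> a}
      \<le> measure_pmf.prob ?M {c \<in> space ?M. exp (- \<delta> * a) \<le> (\<Prod>e\<in>E. h e (c e))}"
    using d by (intro measure_pmf.finite_measure_mono) (auto simp: h_prod mult_left_mono)
  also have "\<dots> \<le> measure_pmf.expectation ?M (\<lambda>c. \<Prod>e\<in>E. h e (c e)) / exp (- \<delta> * a)"
    by (rule integral_Markov_inequality_measure[where A = UNIV])
       (auto simp: h_prod intro!: integrable_measure_pmf_finite[OF fset])
  also have "measure_pmf.expectation ?M (\<lambda>c. \<Prod>e\<in>E. h e (c e))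
      = (\<Prod>e\<in>E. measure_pmf.expectation (bernoulli_pmf p) (h e))"
    by (rule expectation_prod_Pi_pmf[OF fE])
       (auto simp: h_def intro!: integrable_measure_pmf_finite)
  also have "\<dots> = (\<Prod>e\<in>S. p * exp (- \<delta>) + (1 - p))"
    using SE fE p by (intro prod.mono_neutral_cong_right) (auto simp: h_def)
  also have "\<dots> = (p * exp (- \<delta>) + (1 - p)) ^ card S" by simp
  also have "\<dots> \<le> exp (p * (\<delta>\<^sup>2 / 2 - \<delta>)) ^ card S"
  proof (intro power_mono)
    have "exp (- \<delta>) \<le> 1 - \<delta> + \<delta>\<^sup>2 / 2" by (rule exp_minus_le_quadratic[OF d])
    then have "p * exp (- \<delta>) \<le> p * (1 - \<delta> + \<delta>\<^sup>2 / 2)" using p by (intro mult_left_mono)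
    then have "p * exp (- \<delta>) + (1 - p) \<le> 1 + p * (\<delta>\<^sup>2 / 2 - \<delta>)" by (simp add: algebra_simps)
    also have "\<dots> \<le> exp (p * (\<delta>\<^sup>2 / 2 - \<delta>))" by (rule exp_ge_add_one_self)
    finally show "p * exp (- \<delta>) + (1 - p) \<le> exp (p * (\<delta>\<^sup>2 / 2 - \<delta>))" .
  qed (use p in auto)
  also have "\<dots> = exp (real (card S) * (p * (\<delta>\<^sup>2 / 2 - \<delta>)))" by (simp add: exp_of_nat_mult)
  \<comment> \<open>The exponents add up: \<delta>^2 / 2 - \<delta> + \<delta> (1 - \<delta>) = -
    \<delta>^2 / 2, times \<open>p * real (card S)\<close>.\<close>
  also have "\<dots> / exp (- \<delta> * a) = exp (- (\<delta>\<^sup>2 * p * real (card S) / 2))"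
    by (simp add: a_def exp_diff[symmetric] algebra_simps power2_eq_square)
  finally show ?thesis by (simp add: a_def divide_right_mono)
qed

section \<open>Total weight of the pairs of vertex sets\<close>

lemma sum_power_card_Pow:
  fixes t :: "'b::comm_semiring_1"
  assumes "finite A"
  shows "(\<Sum>X\<in>Pow A. t ^ card X) = (1 + t) ^ card A"
  using prod_add[OF assms, of "\<lambda>_. t" "\<lambda>_. 1"] by (simp add: add.commute)

lemma sum_power_card_Pow_Diff:
  fixes t :: "'b::comm_semiring_1"
  assumes "finite A"
  shows "(\<Sum>X\<in>Pow A. t ^ card (A - X)) = (1 + t) ^ card A"
  using prod_add[OF assms, of "\<lambda>_. 1" "\<lambda>_. t"] by simp

text \<open>The sum factors into (1 + t)^n and (1 + t)^n - 1, the -1 coming from the exclusion of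
  the empty \<open>Y\<close>. With z = 2 n t \<le> 1 the product is at most exp z - 1 \<le> z + z^2
  \<le> 2 z.\<close>

lemma sum_weights_le:
  fixes t :: real
  assumes fA: "finite A" and fB: "finite B" and n: "card A = n" "card B = n"
    and t: "0 \<le> t" "2 * real n * t \<le> 1"
  shows "(\<Sum>X\<in>Pow A. \<Sum>Y\<in>Pow B - {{}}. t ^ (card (A - X) + card Y)) \<le> 4 * real n * t"
proof -
  have "(\<Sum>X\<in>Pow A. \<Sum>Y\<in>Pow B - {{}}. t ^ (card (A - X) + card Y))
      = (\<Sum>X\<in>Pow A. t ^ card (A - X)) * (\<Sum>Y\<in>Pow B - {{}}. t ^ card Y)"
    by (simp add: power_add sum_product)
  also have "(\<Sum>Y\<in>Pow B - {{}}. t ^ card Y) = (1 + t) ^ n - 1"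
    using fB sum_power_card_Pow[OF fB, of t] n
    by (simp add: sum_diff1)
  also have "(\<Sum>X\<in>Pow A. t ^ card (A - X)) = (1 + t) ^ n"
    using sum_power_card_Pow_Diff[OF fA, of t] n by simp
  also have "(1 + t) ^ n * ((1 + t) ^ n - 1) \<le> (1 + t) ^ (2 * n) - 1"
  proof -
    define u where "u = (1 + t) ^ n"
    have "1 \<le> u" using t by (simp add: u_def)
    then have "u * (u - 1) \<le> u * u - 1" by (simp add: algebra_simps)
    then show ?thesis by (simp only: u_def mult_2 power_add)
  qed
  also have "(1 + t) ^ (2 * n) \<le> exp t ^ (2 * n)"
    using t by (intro power_mono) (auto simp: exp_ge_add_one_self)
  also have "exp t ^ (2 * n) = exp (2 * real n * t)" by (simp flip: exp_of_nat_mult)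
  also have "exp (2 * real n * t) \<le> 1 + 2 * real n * t + (2 * real n * t)\<^sup>2"
    using t by (intro exp_bound) auto
  also have "(2 * real n * t)\<^sup>2 \<le> 2 * real n * t"
    using mult_left_le[OF t(2), of "2 * real n * t"] t by (simp only: power2_eq_square) simp
  finally show ?thesis by (simp add: mult_ac)
qed

section \<open>Factors of the random subgraph for fixed \<open>n\<close>\<close>

text \<open>The size conditions force |A - X| < |Y| and |A - X| < n / 2. So each vertex of
  \<open>Y\<close> has at least c n neighbours in \<open>X\<close>, and e(X, Y) \<ge> c n |Y| \<ge>
  c n (|A - X| + |Y|) / 2. The 4 in the exponent is this 2 times the 2 from Chernoff.\<close>

lemma prob_few_edges_between_le:
  fixes c p \<delta> :: real
  assumes bip: "bipartite_edges E A B" and n: "card A = n" "card B = n"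
    and deg: "\<And>v. v \<in> A \<union> B \<Longrightarrow> (1 / 2 + c) * real n \<le> real (card {e \<in> E. v \<in> e})"
    and c: "0 \<le> c" and p: "0 \<le> p" "p \<le> 1" and d: "0 \<le> \<delta>"
    and X: "X \<subseteq> A" and Y: "Y \<subseteq> B" and XY: "card Y \<le> card X" "n < card X + card Y"
  shows "measure_pmf.prob (Pi_pmf E False (\<lambda>_. bernoulli_pmf p))
      {\<omega>. real (card {e \<in> edges_between E X Y. \<omega> e}) \<le> (1 - \<delta>) * p * real (card (edges_between E X Y))}
    \<le> exp (- (\<delta>\<^sup>2 * c * p * real n / 4)) ^ (card (A - X) + card Y)"
proof -
  have fA: "finite A" using bip by (simp add: bipartite_edges_def)
  have fE: "finite E" using finite_bipartite_edges[OF bip] .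
  have cX: "card (A - X) + card X = n"
    using X fA n by (metis card_Diff_subset card_mono finite_subset le_add_diff_inverse2)
  let ?e = "real (card (edges_between E X Y))" and ?m = "real (card (A - X) + card Y)"
  have "2 * real (card (A - X)) \<le> real n" using cX XY by linarith
  then have "c * real n \<le> (1 / 2 + c) * real n - real (card (A - X))" by (simp add: algebra_simps)
  then have "real (card Y) * (c * real n) \<le> real (card Y) * ((1 / 2 + c) * real n - real (card (A - X)))"
    by (rule mult_left_mono) simp
  also have "\<dots> \<le> ?e" using deg by (intro dense_edges_between[OF bip X Y]) auto
  finally have e: "real (card Y) * (c * real n) \<le> ?e" .
  have "?m \<le> 2 * real (card Y)" using cX XY by linarith
  then have "?m * (c * real n) \<le> 2 * real (card Y) * (c * real n)"
    using c by (intro mult_right_mono) auto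
  then have "?m * (c * real n) \<le> 2 * ?e" using e by linarith
  then have "(\<delta>\<^sup>2 * p / 4) * (?m * (c * real n)) \<le> (\<delta>\<^sup>2 * p / 4) * (2 * ?e)"
    using p by (intro mult_left_mono) auto
  then have ineq: "- (\<delta>\<^sup>2 * p * ?e / 2) \<le> ?m * - (\<delta>\<^sup>2 * c * p * real n / 4)"
    by (simp add: algebra_simps)
  have "edges_between E X Y \<subseteq> E" by (auto simp: edges_between_def)
  from bernoulli_chernoff_lower[OF fE this p d]
  show ?thesis using ineq unfolding exp_of_nat_mult[symmetric] by (meson exp_le_cancel_iff order_trans)
qed

lemma bipartite_factor_of_cut:
  assumes G: "bipartite_with G A B" and n: "card A = n" "card B = n"
    and cut: "\<And>X Y. X \<subseteq> A \<Longrightarrow> Y \<subseteq> B \<Longrightarrow>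
      k * (card X + card Y) \<le> card (edges_between (edges G) X Y) + k * n"
  shows "has_factor k G"
proof -
  have bip: "bipartite_edges (edges G) A B" and V: "A \<union> B = verts G"
    using G finite_subset[of _ "verts G"]
    by (auto simp: bipartite_with_def bipartite_edges_def simple_graph_def)
  obtain F where "F \<subseteq> edges G" "\<forall>v\<in>A \<union> B. card {e \<in> F. v \<in> e} = k"
    using ore_ryser[OF bip n cut] by blast
  then show ?thesis
    unfolding has_factor_def spanning_subgraph_def regular_def degree_def
    by (intro exI[of _ "Graph (verts G) F"]) (simp add: V)
qed

text \<open>A union bound over the pairs that could violate the Ore-Ryser condition. The error is
  twice that of \<open>sum_weights_le\<close>, once for either order of \<open>card X\<close> and
  \<open>card Y\<close>.\<close>

lemma prob_random_subgraph_has_factor: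
  fixes c p \<delta> :: real and G :: "'v graph"
  defines "t \<equiv> (\<lambda>n. exp (- (\<delta>\<^sup>2 * c * p * real n / 4)))"
  assumes G: "bipartite_with G A B" and n: "card A = n" "card B = n"
    and deg: "(1 / 2 + c) * real n \<le> real (min_degree G)" and fac: "has_factor r G"
    and c: "0 \<le> c" and p: "0 \<le> p" "p \<le> 1" and d: "0 \<le> \<delta>" "\<delta> \<le> 1"
    and k: "real k \<le> (1 - \<delta>) * p * real r" and t: "2 * real n * t n \<le> 1"
  shows "1 - 8 * real n * t n \<le> measure_pmf.prob (random_subgraph G p) {G'. has_factor k G'}"
proof -
  define E where "E = edges G"
  let ?M = "Pi_pmf E False (\<lambda>_. bernoulli_pmf p)"
  have bip: "bipartite_edges E A B" and V: "A \<union> B = verts G" and fV: "finite (verts G)"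
    using G finite_subset[of _ "verts G"]
    by (auto simp: E_def bipartite_with_def bipartite_edges_def simple_graph_def)
  note pib = bipartite_edges_commute[OF bip]
  have fA: "finite A" and fB: "finite B" using bip by (auto simp: bipartite_edges_def)
  have deg': "(1 / 2 + c) * real n \<le> real (card {e \<in> E. v \<in> e})" if "v \<in> A \<union> B" for v
  proof -
    have "min_degree G \<le> degree G v"
      using that V fV unfolding min_degree_def by (intro Min_le) auto
    then show ?thesis using deg by (simp add: degree_def E_def)
  qed
  obtain H where H: "H \<subseteq> E" "\<And>v. v \<in> A \<union> B \<Longrightarrow> card {e \<in> H. v \<in> e} = r"
    using fac V unfolding has_factor_def spanning_subgraph_def regular_def degree_def E_def by metis
  \<comment> \<open>The cut inequality holds for the factor \<open>H\<close> and survives adding the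
    remaining edges of \<open>E\<close>.\<close>
  have rE: "r * (card X + card Y) \<le> card (edges_between E X Y) + r * n"
    if "X \<subseteq> A" "Y \<subseteq> B" for X Y
  proof -
    have "card (edges_between H X Y) \<le> card (edges_between E X Y)"
      using edges_between_mono[OF H(1)] finite_bipartite_edges[OF bip]
      by (intro card_mono) (auto simp: edges_between_def)
    then show ?thesis
      using regular_edges_between[OF bipartite_edges_mono[OF bip H(1)] n(2) H(2) that] by simp
  qed

  define bad where "bad X Y = {\<omega>. real (card {e \<in> edges_between E X Y. \<omega> e})
    \<le> (1 - \<delta>) * p * real (card (edges_between E X Y))}" for X Y
  \<comment> \<open>For all other pairs the cut condition holds trivially.\<close>
  define I where "I = {(X, Y). X \<subseteq> A \<and> Y \<subseteq> B \<and> n < card X + card Y}"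
  have fI: "finite I"
    by (rule finite_subset[of _ "Pow A \<times> Pow B"]) (use fA fB in \<open>auto simp: I_def\<close>)
  have good: "has_factor k (Graph (verts G) {e \<in> edges G. \<omega> e})"
    if \<omega>: "\<omega> \<notin> (\<Union>(X, Y)\<in>I. bad X Y)" for \<omega>
  proof (rule bipartite_factor_of_cut[OF _ n])
    show "bipartite_with (Graph (verts G) {e \<in> edges G. \<omega> e}) A B"
      using G by (auto simp: bipartite_with_def simple_graph_def)
    fix X Y assume XY: "X \<subseteq> A" "Y \<subseteq> B"
    have eF: "edges_between {e \<in> E. \<omega> e} X Y = {e \<in> edges_between E X Y. \<omega> e}"
      by (auto simp: edges_between_def)
    have "k * (card X + card Y) \<le> card (edges_between {e \<in> E. \<omega> e} X Y) + k * n"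
    proof (cases "n < card X + card Y")
      case False
      then show ?thesis by (simp add: trans_le_add2)
    next
      case True
      \<comment> \<open>In these terms e(X, Y) is at least r D in \<open>G\<close>, hence more than
        (1 - \<delta>) p r D \<ge> k D edges survive or at least that many are forced: a pair that
        is not bad keeps at least k D edges.\<close>
      define D where "D = real (card X + card Y) - real n"
      have D: "0 \<le> D" using True by (simp add: D_def)
      have "\<omega> \<notin> bad X Y" using \<omega> XY True by (auto simp: I_def)
      then have lt: "(1 - \<delta>) * p * real (card (edges_between E X Y))
          < real (card (edges_between {e \<in> E. \<omega> e} X Y))"
        unfolding eF by (simp add: bad_def)
      have "real (r * (card X + card Y)) \<le> real (card (edges_between E X Y) + r * n)"
        using rE[OF XY] of_nat_mono by blast
      then have "real r * D \<le> real (card (edges_between E X Y))"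
        by (simp add: D_def algebra_simps)
      then have "(1 - \<delta>) * p * (real r * D) \<le> (1 - \<delta>) * p * real (card (edges_between E X Y))"
        using p d by (intro mult_left_mono) auto
      moreover have "real k * D \<le> (1 - \<delta>) * p * real r * D" using k D by (rule mult_right_mono)
      ultimately have "real k * D \<le> real (card (edges_between {e \<in> E. \<omega> e} X Y))"
        using lt by (simp add: mult.assoc)
      then have "real (k * (card X + card Y)) \<le> real (card (edges_between {e \<in> E. \<omega> e} X Y) + k * n)"
        by (simp add: D_def algebra_simps)
      then show ?thesis by (simp only: of_nat_le_iff)
    qed
    then show "k * (card X + card Y)
        \<le> card (edges_between (edges (Graph (verts G) {e \<in> edges G. \<omega> e})) X Y) + k * n"
      by (simp add: E_def)
  qed

  \<comment> \<open>\<open>w\<close> serves the pairs with \<open>card Y \<le> card X\<close>;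
    \<open>w'\<close> serves the others, with \<open>A\<close> and \<open>B\<close> exchanged.
    Bounding by \<open>w + w'\<close> avoids splitting \<open>I\<close>.\<close>
  define w where "w X Y = t n ^ (card (A - X) + card Y)" for X Y :: "'v set"
  define w' where "w' X Y = t n ^ (card (B - Y) + card X)" for X Y :: "'v set"
  have w0: "0 \<le> w X Y" "0 \<le> w' X Y" for X Y by (auto simp: w_def w'_def t_def)
  have bad_le: "measure_pmf.prob ?M (bad X Y) \<le> w X Y + w' X Y" if "(X, Y) \<in> I" for X Y
  proof (cases "card Y \<le> card X")
    case True
    then have "measure_pmf.prob ?M (bad X Y) \<le> w X Y"
      using prob_few_edges_between_le[OF bip n _ c p d(1), of X Y] deg' that
      by (auto simp: bad_def w_def t_def I_def)
    then show ?thesis using w0[of X Y] by linarith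
  next
    case False
    then have "measure_pmf.prob ?M (bad X Y) \<le> w' X Y"
      using prob_few_edges_between_le[OF pib n(2,1) _ c p d(1), of Y X] deg' that
      by (auto simp: bad_def w'_def t_def I_def edges_between_commute[of E Y X] add.commute Un_commute)
    then show ?thesis using w0[of X Y] by linarith
  qed
  have t0: "0 \<le> t n" by (simp add: t_def)
  \<comment> \<open>Neither set can exceed \<open>n\<close>, so both are nonempty; without this the
    weight of the pair (A, {}) would already be 1.\<close>
  have I_sub: "I \<subseteq> Pow A \<times> (Pow B - {{}})" "I \<subseteq> (Pow A - {{}}) \<times> Pow B"
  proof -
    have "X \<noteq> {} \<and> Y \<noteq> {}" if "(X, Y) \<in> I" for X Y
    proof -
      have "card X \<le> n" "card Y \<le> n" "n < card X + card Y"
        using that n card_mono[OF fA, of X] card_mono[OF fB, of Y] by (auto simp: I_def)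
      then show ?thesis by auto
    qed
    then show "I \<subseteq> Pow A \<times> (Pow B - {{}})" "I \<subseteq> (Pow A - {{}}) \<times> Pow B"
      by (auto simp: I_def)
  qed
  have "(\<Sum>(X, Y)\<in>I. w X Y) \<le> (\<Sum>(X, Y)\<in>Pow A \<times> (Pow B - {{}}). w X Y)"
    using fA fB w0 I_sub by (intro sum_mono2) auto
  also have "\<dots> \<le> 4 * real n * t n"
    using sum_weights_le[OF fA fB n t0 t] by (simp add: w_def sum.cartesian_product)
  finally have sw: "(\<Sum>(X, Y)\<in>I. w X Y) \<le> 4 * real n * t n" .
  have "(\<Sum>(X, Y)\<in>I. w' X Y) \<le> (\<Sum>(X, Y)\<in>(Pow A - {{}}) \<times> Pow B. w' X Y)"
    using fA fB w0 I_sub by (intro sum_mono2) auto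
  also have "\<dots> = (\<Sum>X\<in>Pow A - {{}}. \<Sum>Y\<in>Pow B. w' X Y)" by (simp add: sum.cartesian_product)
  also have "\<dots> = (\<Sum>Y\<in>Pow B. \<Sum>X\<in>Pow A - {{}}. w' X Y)" by (rule sum.swap)
  also have "\<dots> \<le> 4 * real n * t n"
    using sum_weights_le[OF fB fA n(2,1) t0 t] by (simp add: w'_def)
  finally have sw': "(\<Sum>(X, Y)\<in>I. w' X Y) \<le> 4 * real n * t n" .
  have "measure_pmf.prob ?M (\<Union>(X, Y)\<in>I. bad X Y) \<le> (\<Sum>(X, Y)\<in>I. measure_pmf.prob ?M (bad X Y))"
    using measure_pmf.finite_measure_subadditive_finite[OF fI, of "\<lambda>(X, Y). bad X Y" ?M]
    by (simp add: case_prod_unfold)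
  also have "\<dots> \<le> (\<Sum>(X, Y)\<in>I. w X Y + w' X Y)" using bad_le by (intro sum_mono) auto
  also have "\<dots> = (\<Sum>(X, Y)\<in>I. w X Y) + (\<Sum>(X, Y)\<in>I. w' X Y)"
    by (simp add: case_prod_unfold sum.distrib)
  finally have "measure_pmf.prob ?M (\<Union>(X, Y)\<in>I. bad X Y) \<le> 8 * real n * t n" using sw sw' by linarith
  then have "1 - 8 * real n * t n \<le> measure_pmf.prob ?M (- (\<Union>(X, Y)\<in>I. bad X Y))"
    by (simp add: measure_pmf.prob_compl[of _ ?M, simplified] Compl_eq_Diff_UNIV)
  also have "\<dots> \<le> measure_pmf.prob ?M {\<omega>. has_factor k (Graph (verts G) {e \<in> edges G. \<omega> e})}"
    using good by (intro measure_pmf.finite_measure_mono) auto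
  also have "\<dots> = measure_pmf.prob (random_subgraph G p) {G'. has_factor k G'}"
    by (simp add: random_subgraph_def E_def vimage_def)
  finally show ?thesis .
qed

section \<open>Constants and asymptotics\<close>

theorem theorem1p4:
  fixes \<alpha> \<epsilon> \<rho> :: real and p :: "nat \<Rightarrow> real"
  assumes "1/2 < \<alpha>" and "\<alpha> \<le> 1" and "0 < \<epsilon>" and "0 < \<rho>" and "\<rho> \<le> \<alpha>"
    and "\<And>n. n \<ge> 1 \<Longrightarrow> 0 < p n \<and> p n \<le> 1"
    and "filterlim (\<lambda>n. p n * real n / ln (real n)) at_top sequentially"
  shows "\<exists>g :: nat \<Rightarrow> real. filterlim g at_top sequentially \<and>
    (\<forall>\<^sub>F n in sequentially. \<forall>(G :: 'v graph) A B.
       bipartite_with G A B \<and> card A = n \<and> card B = n \<and>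
       real (min_degree G) \<ge> \<alpha> * real n \<and>
       has_factor (nat \<lfloor>\<rho> * real n\<rfloor>) G \<longrightarrow>
       measure_pmf.prob (random_subgraph G (p n))
         {G'. has_factor (nat \<lfloor>(1 - \<epsilon>) * \<rho> * real n * p n\<rfloor>) G'}
       \<ge> 1 - real n powr (- g n))"
proof -
  \<comment> \<open>Half of the loss \<open>\<epsilon>\<close> pays for the deviation from the mean,
    the other half for rounding \<rho> n down. The minimum with 1 keeps
    \<open>1 - 2 * \<delta>\<close> nonnegative.\<close>
  define \<delta> where "\<delta> = min \<epsilon> 1 / 2"
  have d: "0 < \<delta>" "\<delta> \<le> 1 / 2" "1 - \<epsilon> \<le> 1 - 2 * \<delta>" using assms(3) by (auto simp: \<delta>_def)
  define c where "c = \<alpha> - 1 / 2"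
  have c: "0 < c" using assms(1) by (simp add: c_def)
  define K where "K = \<delta>\<^sup>2 * c / 4"
  have K: "0 < K" using d c by (simp add: K_def)
  \<comment> \<open>Chosen so that the error parameter
    \<open>exp (- (\<delta>\<^sup>2 * c * p n * real n / 4))\<close> equals
    \<open>real n powr (- s n)\<close>.\<close>
  define s where "s n = K * (p n * real n / ln (real n))" for n
  have s_lim: "filterlim s at_top sequentially"
    unfolding s_def using assms(7) K by (intro filterlim_tendsto_pos_mult_at_top[of _ K] tendsto_const)
  \<comment> \<open>The witness is s - 4: for n \<ge> 2 the factor 8 n of the error is at most
    n^4.\<close>
  have "filterlim (\<lambda>n. - 4 + s n) at_top sequentially"
    by (rule filterlim_tendsto_add_at_top[OF tendsto_const s_lim])
  moreover have "\<forall>\<^sub>F n in sequentially. \<forall>(G :: 'v graph) A B.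
       bipartite_with G A B \<and> card A = n \<and> card B = n \<and>
       real (min_degree G) \<ge> \<alpha> * real n \<and>
       has_factor (nat \<lfloor>\<rho> * real n\<rfloor>) G \<longrightarrow>
       measure_pmf.prob (random_subgraph G (p n))
         {G'. has_factor (nat \<lfloor>(1 - \<epsilon>) * \<rho> * real n * p n\<rfloor>) G'}
       \<ge> 1 - real n powr (- (- 4 + s n))"
    \<comment> \<open>\<open>s n > 2\<close> gives 2 n t \<le> 2 / n \<le> 1, and the last threshold
      makes \<delta> \<rho> n at least 1, which absorbs the rounding.\<close>
    using filterlim_at_top_dense[THEN iffD1, OF s_lim, rule_format, of 2] eventually_ge_at_top[of "2::nat"]
      eventually_ge_at_top[of "nat \<lceil>1 / (\<delta> * \<rho>)\<rceil>"]
  proof eventually_elim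
    case (elim n)
    define t where "t = exp (- (\<delta>\<^sup>2 * c * p n * real n / 4))"
    have n2: "2 \<le> real n" and p: "0 < p n" "p n \<le> 1" using elim assms(6)[of n] by auto
    have t: "t = real n powr (- s n)"
      using n2 by (simp add: t_def powr_def s_def K_def)
    have "t \<le> real n powr (- 2)" unfolding t using n2 elim by (intro powr_mono) auto
    also have "\<dots> = 1 / (real n)\<^sup>2" using n2 by (simp add: powr_minus_divide)
    finally have "2 * real n * t \<le> 2 * real n * (1 / (real n)\<^sup>2)" by (rule mult_left_mono) simp
    also have "\<dots> \<le> 1" using n2 by (simp add: power2_eq_square field_simps)
    finally have t1: "2 * real n * t \<le> 1" .
    have "real n powr (- (- 4 + s n)) = real n ^ 4 * t"
      using n2 by (simp add: t powr_diff powr_minus divide_inverse)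
    moreover have "8 * real n \<le> real n ^ 4"
    proof -
      have "2 ^ 3 * real n \<le> real n ^ 3 * real n" using n2 by (intro mult_right_mono power_mono) auto
      then show ?thesis by (simp add: eval_nat_numeral mult.assoc)
    qed
    ultimately have nt: "8 * real n * t \<le> real n powr (- (- 4 + s n))"
      by (simp add: mult_right_mono t_def)
    have "1 / (\<delta> * \<rho>) \<le> real n" using elim by linarith
    then have "1 \<le> \<delta> * \<rho> * real n" using d assms(4) by (simp add: field_simps)
    then have "(1 - 2 * \<delta>) * (\<rho> * real n) \<le> (1 - \<delta>) * (\<rho> * real n - 1)"
      using d by (simp add: algebra_simps)
    also have "\<dots> \<le> (1 - \<delta>) * real (nat \<lfloor>\<rho> * real n\<rfloor>)"
      using d by (intro mult_left_mono) linarith+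
    finally have "(1 - 2 * \<delta>) * (\<rho> * real n) * p n \<le> (1 - \<delta>) * real (nat \<lfloor>\<rho> * real n\<rfloor>) * p n"
      using p by (intro mult_right_mono) auto
    moreover have "real (nat \<lfloor>(1 - \<epsilon>) * \<rho> * real n * p n\<rfloor>) \<le> (1 - 2 * \<delta>) * (\<rho> * real n) * p n"
    proof -
      have "(1 - \<epsilon>) * (\<rho> * real n * p n) \<le> (1 - 2 * \<delta>) * (\<rho> * real n * p n)"
        using d p assms(4) by (intro mult_right_mono) auto
      \<comment> \<open>Covers \<epsilon> > 1, where the floor is negative and \<open>nat\<close>
        turns it into 0.\<close>
      moreover have "0 \<le> (1 - 2 * \<delta>) * (\<rho> * real n * p n)" using d p assms(4) by simp
      ultimately show ?thesis by (simp only: mult.assoc) linarith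
    qed
    ultimately have k: "real (nat \<lfloor>(1 - \<epsilon>) * \<rho> * real n * p n\<rfloor>)
        \<le> (1 - \<delta>) * p n * real (nat \<lfloor>\<rho> * real n\<rfloor>)" by (simp add: mult_ac)
    show ?case
    proof (intro allI impI, elim conjE)
      fix G :: "'v graph" and A B
      assume G: "bipartite_with G A B" "card A = n" "card B = n"
        and deg: "\<alpha> * real n \<le> real (min_degree G)" and fac: "has_factor (nat \<lfloor>\<rho> * real n\<rfloor>) G"
      have "1 - 8 * real n * t \<le> measure_pmf.prob (random_subgraph G (p n))
          {G'. has_factor (nat \<lfloor>(1 - \<epsilon>) * \<rho> * real n * p n\<rfloor>) G'}"
        unfolding t_def
        by (rule prob_random_subgraph_has_factor[OF G _ fac])
          (use deg c p d k t1 in \<open>auto simp: c_def t_def\<close>)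
      then show "1 - real n powr (- (- 4 + s n)) \<le> measure_pmf.prob (random_subgraph G (p n))
          {G'. has_factor (nat \<lfloor>(1 - \<epsilon>) * \<rho> * real n * p n\<rfloor>) G'}" using nt by linarith
    qed
  qed
  ultimately show ?thesis by blast
qed

end
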